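(* The following statements hold. 1. For every real $s>2$, there exists a function $f_s:\mathbb{N}\to\mathbb{N}$ with $f_s(0)=1$, $f_s(1)=2$ and $f_s(x)>x$ for all $x$, such that the round complexity of the Increasing Degree problem $\Pi_{f_s}$ in $n$-node graphs is $\Theta(n^{1/s})$. 2. For every real $\gamma>1$, there exists a function $f_\gamma:\mathbb{N}\to\mathbb{N}$ with $f_\gamma(0)=1$, $f_\gamma(1)=2$ and $f_\gamma(x)>x$ for all $x$, such that the round complexity of the Increasing Degree problem $\Pi_{f_\gamma}$ in $n$-node graphs is $\Theta(\log^{\gamma} n)$, where $\log^\gamma n=(\log n)^\gamma$.
   Context: Notation. $\mathbb{N}=\{0,1,2,\dots\}$. LOCAL model. The network is a simple connected graph $G=(V,E)$ with $n\ge 1$ nodes. Each node has an identifier in $[0,N]$, unique in the network, where $N$ is an upper bound on $n$ polynomial in $n$; $N$ may be given to the nodes. Initially a node knows only its identifier, degree and input label (and $N$). Computation proceeds in synchronous rounds, in each of which every node performs local computation and exchanges messages of arbitrary size with its neighbors; each node eventually outputs a label. The round complexity of a problem in $n$-node graphs is the minimum, over all deterministic algorithms solving it, of the maximum, over all $n$-node graphs (and identifier and input assignments), of the number of rounds until all nodes have output. Increasing Degree problem $\Pi_f$, for a function $f:\mathbb{N}\to\mathbb{N}$ with $f(x)>x$ for all $x$. A leaf is a node of degree $1$; $N(v)$ is the set of neighbors of $v$; $\sharp\mathrm{leaf}(v)$ is the number of leaves adjacent to $v$. A node $v$ is balanced (w.r.t. $f$) if $\deg(v)=1$ or $\sharp\mathrm{leaf}(w)<f(\sharp\mathrm{leaf}(v))$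 for all $w\in N(v)$; otherwise it is unbalanced, and every $w\in N(v)$ with $\sharp\mathrm{leaf}(w)\ge f(\sharp\mathrm{leaf}(v))$ is called a heavy neighbor of $v$. Each node $v$ receives an arbitrary input $\ell_{in}(v)\in\{0,1\}$ and must output $\ell_{out}(v)\in\{0,1\}$ such that: if $v$ is balanced then $\ell_{out}(v)=\ell_{in}(v)$; if $v$ is unbalanced then $\ell_{out}(v)=\ell_{out}(w)$ for at least one heavy neighbor $w$ of $v$. An algorithm solves $\Pi_f$ if these conditions hold at all nodes, for every input graph and every input assignment. *)

theory Defs
  imports Complex_Main "HOL-Library.Extended_Nat" "HOL-Library.Landau_Symbols"
begin

text \<open>
  A network is a graph together with everything else the adversary chooses: the identifiers, the
  input labels (the labels 0 and 1 are \<^term>\<open>False\<close> and \<^term>\<open>True\<close>), and the order in which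
  a node sees its incident links.  \<open>ports I v\<close> lists the neighbors of \<open>v\<close>; its \<open>i\<close>-th entry is
  the neighbor behind port \<open>i\<close> of \<open>v\<close>.  The elements of \<open>nodes I\<close> are mere names that the
  nodes themselves never see; edges are stored in both directions.
\<close>

record network =
  nodes :: "nat set"
  edges :: "(nat \<times> nat) set"
  ident :: "nat \<Rightarrow> nat"
  inlabel :: "nat \<Rightarrow> bool"
  ports :: "nat \<Rightarrow> nat list"

definition neighbors :: "network \<Rightarrow> nat \<Rightarrow> nat set" where
  "neighbors I v = {w. (v, w) \<in> edges I}"

definition degree :: "network \<Rightarrow> nat \<Rightarrow> nat" where
  "degree I v = card (neighbors I v)"

definition simple_connected_graph :: "network \<Rightarrow> bool" where
  "simple_connected_graph I \<longleftrightarrow>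
     finite (nodes I) \<and> nodes I \<noteq> {} \<and>
     edges I \<subseteq> nodes I \<times> nodes I \<and> sym (edges I) \<and> irrefl (edges I) \<and>
     (\<forall>u\<in>nodes I. \<forall>v\<in>nodes I. (u, v) \<in> (edges I)\<^sup>*)"

definition valid_network :: "nat \<Rightarrow> network \<Rightarrow> bool" where
  "valid_network N I \<longleftrightarrow>
     simple_connected_graph I \<and>
     inj_on (ident I) (nodes I) \<and> ident I ` nodes I \<subseteq> {0..N} \<and>
     (\<forall>v\<in>nodes I. distinct (ports I v) \<and> set (ports I v) = neighbors I v)"

text \<open>
  \<open>N n\<close> is the upper bound on the identifiers used in \<open>n\<close>-node networks.
\<close>

definition poly_id_bound :: "(nat \<Rightarrow> nat) \<Rightarrow> bool" where
  "poly_id_bound N \<longleftrightarrow>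
     (\<forall>n\<ge>1. n \<le> N n) \<and> (\<exists>k::nat. (\<lambda>n. real (N n)) \<in> O(\<lambda>n. real n ^ k))"

definition instances :: "(nat \<Rightarrow> nat) \<Rightarrow> nat \<Rightarrow> network set" where
  "instances N n = {I. card (nodes I) = n \<and> valid_network (N n) I}"

text \<open>
  States and messages are finite pieces of data of unbounded size, encoded as natural numbers.
  The arguments of \<open>init\<close> are the bound on the identifiers and the node's identifier, degree and
  input label; \<open>send s i\<close> is the message sent through port \<open>i\<close> in state \<open>s\<close>; \<open>recv s ms\<close> is
  the new state, where \<open>ms ! i\<close> is the message received through port \<open>i\<close>; and \<open>out s\<close> is
  \<^term>\<open>None\<close> as long as the node has not decided.
\<close>

record algorithm =
  init :: "nat \<Rightarrow> nat \<Rightarrow> nat \<Rightarrow> bool \<Rightarrow> nat"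
  send :: "nat \<Rightarrow> nat \<Rightarrow> nat"
  recv :: "nat \<Rightarrow> nat list \<Rightarrow> nat"
  out :: "nat \<Rightarrow> bool option"

definition port_to :: "network \<Rightarrow> nat \<Rightarrow> nat \<Rightarrow> nat" where
  "port_to I w v = (THE i. i < length (ports I w) \<and> ports I w ! i = v)"

primrec state :: "algorithm \<Rightarrow> nat \<Rightarrow> network \<Rightarrow> nat \<Rightarrow> nat \<Rightarrow> nat" where
  "state A N I 0 v = init A N (ident I v) (degree I v) (inlabel I v)"
| "state A N I (Suc t) v =
     recv A (state A N I t v)
       (map (\<lambda>w. send A (state A N I t w) (port_to I w v)) (ports I v))"

text \<open>
  A node outputs in the first round after which \<^const>\<open>out\<close> yields a label; this label is final,
  but the node keeps on exchanging messages.
\<close>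

definition output_round :: "algorithm \<Rightarrow> nat \<Rightarrow> network \<Rightarrow> nat \<Rightarrow> enat" where
  "output_round A N I v = (INF t\<in>{t. out A (state A N I t v) \<noteq> None}. enat t)"

definition outputs :: "algorithm \<Rightarrow> nat \<Rightarrow> network \<Rightarrow> nat \<Rightarrow> bool \<Rightarrow> bool" where
  "outputs A N I v b \<longleftrightarrow>
     (\<exists>t. output_round A N I v = enat t \<and> out A (state A N I t v) = Some b)"

definition rounds :: "algorithm \<Rightarrow> nat \<Rightarrow> network \<Rightarrow> enat" where
  "rounds A N I = (SUP v\<in>nodes I. output_round A N I v)"

definition num_leaves :: "network \<Rightarrow> nat \<Rightarrow> nat" where
  "num_leaves I v = card {w \<in> neighbors I v. degree I w = 1}"

definition balanced :: "(nat \<Rightarrow> nat) \<Rightarrow> network \<Rightarrow> nat \<Rightarrow> bool" where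
  "balanced f I v \<longleftrightarrow>
     degree I v = 1 \<or> (\<forall>w\<in>neighbors I v. num_leaves I w < f (num_leaves I v))"

definition heavy_neighbors :: "(nat \<Rightarrow> nat) \<Rightarrow> network \<Rightarrow> nat \<Rightarrow> nat set" where
  "heavy_neighbors f I v = {w \<in> neighbors I v. f (num_leaves I v) \<le> num_leaves I w}"

definition correct_labeling :: "(nat \<Rightarrow> nat) \<Rightarrow> network \<Rightarrow> (nat \<Rightarrow> bool) \<Rightarrow> bool" where
  "correct_labeling f I l \<longleftrightarrow>
     (\<forall>v\<in>nodes I.
        (balanced f I v \<longrightarrow> l v = inlabel I v) \<and>
        (\<not> balanced f I v \<longrightarrow> (\<exists>w\<in>heavy_neighbors f I v. l v = l w)))"

definition solves :: "(nat \<Rightarrow> nat) \<Rightarrow> (nat \<Rightarrow> nat) \<Rightarrow> algorithm \<Rightarrow> bool" where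
  "solves f N A \<longleftrightarrow>
     (\<forall>n. \<forall>I\<in>instances N n.
        \<exists>l. (\<forall>v\<in>nodes I. outputs A (N n) I v (l v)) \<and> correct_labeling f I l)"

definition round_complexity :: "(nat \<Rightarrow> nat) \<Rightarrow> (nat \<Rightarrow> nat) \<Rightarrow> nat \<Rightarrow> enat" where
  "round_complexity f N n =
     (INF A\<in>{A. solves f N A}. SUP I\<in>instances N n. rounds A (N n) I)"

text \<open>
  The constants hidden in the asymptotic bound may depend on the identifier bound \<open>N\<close>.
\<close>

definition has_round_complexity_Theta :: "(nat \<Rightarrow> nat) \<Rightarrow> (nat \<Rightarrow> real) \<Rightarrow> bool" where
  "has_round_complexity_Theta f g \<longleftrightarrow>
     (\<forall>N. poly_id_bound N \<longrightarrow>
        (\<forall>n\<ge>1. round_complexity f N n \<noteq> \<infinity>) \<and>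
        (\<lambda>n. real (the_enat (round_complexity f N n))) \<in> \<Theta>(g))"

end

theory Submission
  imports Defs "HOL-Library.Countable" "HOL-Real_Asymp.Real_Asymp"
begin

text \<open>
  Let \<open>b\<close> be strictly increasing with \<open>b 0 = 0\<close>, and let \<open>f x\<close> be the least value of \<open>b\<close> above
  \<open>x\<close>.  An unbalanced node can wait until some fixed heavy neighbor has decided and copy its label.
  A node still waiting after \<open>t\<close> rounds of this starts a chain of heavy neighbors whose leaf numbers
  are at least \<open>b 0, b 1, \<dots>, b t\<close>; since the leaves of distinct nodes are distinct,
  \<open>b 0 + \<dots> + b t \<le> n\<close>.  Conversely, on a path whose nodes carry \<open>b 1, b 2, \<dots>, b (k + 1)\<close>
  leaves, the first node must output the input label of the last one and hence needs \<open>k\<close> rounds.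
  So the complexity is, up to constants, the largest \<open>k\<close> with \<open>b 0 + \<dots> + b k \<le> n\<close>, and it
  remains to let \<open>b i\<close> grow like \<open>i powr (s - 1)\<close> or \<open>exp (i powr (1 / \<gamma>))\<close>.
\<close>

section \<open>The least level above a number\<close>

definition next_level :: "(nat \<Rightarrow> nat) \<Rightarrow> nat \<Rightarrow> nat" where
  "next_level b x = b (LEAST i. x < b i)"

lemma next_level_gt:
  assumes "strict_mono b"
  shows "x < next_level b x"
proof -
  have "x < b (Suc x)"
    using strict_mono_imp_increasing[OF assms, of "Suc x"] by simp
  then show ?thesis
    unfolding next_level_def by (rule LeastI)
qed

text \<open>Hence a heavy neighbor sits at least one level index higher, so chains of heavy
  neighbors climb through \<open>b\<close>.\<close>

lemma next_level_ge:
  assumes "strict_mono b" "b i \<le> x"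
  shows "b (Suc i) \<le> next_level b x"
proof -
  have "x < b (LEAST i. x < b i)"
    using next_level_gt[OF assms(1), of x] by (simp add: next_level_def)
  then have "b i < b (LEAST i. x < b i)"
    using assms(2) by simp
  then have "i < (LEAST i. x < b i)"
    using assms(1) by (simp add: strict_mono_less)
  then show ?thesis
    using assms(1) by (simp add: next_level_def strict_mono_less_eq)
qed

lemma next_level_apply:
  assumes "strict_mono b"
  shows "next_level b (b i) = b (Suc i)"
  unfolding next_level_def
  by (rule arg_cong[where f = b], rule Least_equality) (use assms in \<open>auto simp: strict_mono_less\<close>)


section \<open>Forwarding labels along heavy neighbors\<close>

text \<open>The arguments stand for degree, input label and leaf number; \<open>Waiting\<close>
  holds the port of the neighbor whose label is to be copied. Countability permits the encoding as
  states of an \<open>algorithm\<close>.\<close>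

datatype phase = Start nat bool | Counted nat bool nat | Waiting nat | Done bool

instance phase :: countable
  by countable_datatype

definition heavy_ports :: "(nat \<Rightarrow> nat) \<Rightarrow> nat \<Rightarrow> phase list \<Rightarrow> nat set" where
  "heavy_ports f c ms = {i. i < length ms \<and> (\<exists>d x c'. ms ! i = Counted d x c' \<and> f c \<le> c')}"

text \<open>Round one counts leaves by their \<open>Start 1\<close> messages, round two compares the
  exchanged counts and either decides or fixes a port, and later rounds copy.\<close>

fun step :: "(nat \<Rightarrow> nat) \<Rightarrow> phase \<Rightarrow> phase list \<Rightarrow> phase" where
  "step f (Start d x) ms = Counted d x (length (filter (\<lambda>m. \<exists>y. m = Start 1 y) ms))"
| "step f (Counted d x c) ms =
     (if d = 1 \<or> heavy_ports f c ms = {} then Done x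
      else Waiting (LEAST i. i \<in> heavy_ports f c ms))"
| "step f (Waiting i) ms = (case ms ! i of Done y \<Rightarrow> Done y | _ \<Rightarrow> Waiting i)"
| "step f (Done x) ms = Done x"

definition forwarding :: "(nat \<Rightarrow> nat) \<Rightarrow> algorithm" where
  "forwarding f =
     \<lparr>init = (\<lambda>_ _ d x. to_nat (Start d x)),
      send = (\<lambda>s _. s),
      recv = (\<lambda>s ms. to_nat (step f (from_nat s) (map from_nat ms))),
      out = (\<lambda>s. case from_nat s of Done x \<Rightarrow> Some x | _ \<Rightarrow> None)\<rparr>"

primrec phase_at :: "(nat \<Rightarrow> nat) \<Rightarrow> network \<Rightarrow> nat \<Rightarrow> nat \<Rightarrow> phase" where
  "phase_at f I 0 v = Start (degree I v) (inlabel I v)"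
| "phase_at f I (Suc t) v = step f (phase_at f I t v) (map (phase_at f I t) (ports I v))"

declare phase_at.simps(2) [simp del]

text \<open>Removes the encoding, so that the run can be studied through
  \<open>phase_at\<close>.\<close>

lemma state_forwarding: "state (forwarding f) N I t v = to_nat (phase_at f I t v)"
  by (induction t arbitrary: v) (simp_all add: forwarding_def comp_def phase_at.simps(2))

lemma out_forwarding:
  "out (forwarding f) (state (forwarding f) N I t v) = Some x \<longleftrightarrow> phase_at f I t v = Done x"
  by (simp add: state_forwarding) (simp add: forwarding_def split: phase.split)

lemma phase_at_1:
  assumes "distinct (ports I v)" "set (ports I v) = neighbors I v"
  shows "phase_at f I (Suc 0) v = Counted (degree I v) (inlabel I v) (num_leaves I v)"
proof -
  have "length (filter (\<lambda>w. degree I w = 1) (ports I v)) = num_leaves I v"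
    unfolding num_leaves_def using assms
    by (subst distinct_card[symmetric]) auto
  then show ?thesis
    by (simp add: filter_map comp_def phase_at.simps(2))
qed

lemma phase_at_Done_mono:
  assumes "phase_at f I t v = Done x" "t \<le> t'"
  shows "phase_at f I t' v = Done x"
  using assms(2,1) by (induction rule: dec_induct) (auto simp: phase_at.simps(2))

lemma phase_at_Done_unique:
  assumes "phase_at f I t v = Done x" "phase_at f I t' v = Done y"
  shows "x = y"
  using phase_at_Done_mono[OF assms(1), of "max t t'"] phase_at_Done_mono[OF assms(2), of "max t t'"]
  by simp

text \<open>\<open>outputs\<close> refers to the first decided round. Since \<open>Done\<close> is
  never left or changed, a label seen in any round is the official one.\<close>

lemma outputs_forwardingI:
  assumes "phase_at f I t v = Done x"
  shows "outputs (forwarding f) N I v x" "output_round (forwarding f) N I v \<le> enat t"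
proof -
  let ?T = "{t. out (forwarding f) (state (forwarding f) N I t v) \<noteq> None}"
  have t: "t \<in> ?T"
    using assms out_forwarding[of f N I t v x] by simp
  then show "output_round (forwarding f) N I v \<le> enat t"
    unfolding output_round_def by (rule INF_lower)
  \<comment> \<open>The infimum of a nonempty set in the well-order \<open>enat\<close> is
    attained.\<close>
  have "Inf (enat ` ?T) \<in> enat ` ?T"
    using t by (intro wellorder_InfI) auto
  then obtain t' where t': "t' \<in> ?T" "output_round (forwarding f) N I v = enat t'"
    unfolding output_round_def by auto
  then obtain y where y: "out (forwarding f) (state (forwarding f) N I t' v) = Some y"
    by auto
  then have "y = x"
    using assms by (auto simp: out_forwarding dest: phase_at_Done_unique)
  with t' y show "outputs (forwarding f) N I v x"
    unfolding outputs_def by auto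
qed

section \<open>Forwarding on a fixed network\<close>

context
  fixes I :: network and N :: nat and f :: "nat \<Rightarrow> nat"
  assumes valid: "valid_network N I"
begin

lemma neighbors_subset: "neighbors I v \<subseteq> nodes I"
  using valid by (auto simp: valid_network_def simple_connected_graph_def neighbors_def)

lemma finite_nodes: "finite (nodes I)"
  using valid by (auto simp: valid_network_def simple_connected_graph_def)

lemma set_ports: "v \<in> nodes I \<Longrightarrow> set (ports I v) = neighbors I v"
  using valid by (auto simp: valid_network_def)

lemma phase_at_Suc_0:
  assumes "v \<in> nodes I"
  shows "phase_at f I (Suc 0) v = Counted (degree I v) (inlabel I v) (num_leaves I v)"
  using phase_at_1[of I v f] valid assms by (auto simp: valid_network_def)

lemma phase_at_2:
  assumes v: "v \<in> nodes I"
  shows "(balanced f I v \<and> phase_at f I 2 v = Done (inlabel I v)) \<or>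
         (\<not> balanced f I v \<and> (\<exists>i < length (ports I v).
            ports I v ! i \<in> heavy_neighbors f I v \<and> phase_at f I 2 v = Waiting i))"
proof -
  define ms where "ms = map (phase_at f I (Suc 0)) (ports I v)"
  have ms: "ms ! i = Counted (degree I (ports I v ! i)) (inlabel I (ports I v ! i))
      (num_leaves I (ports I v ! i))" if "i < length (ports I v)" for i
  proof -
    have "ports I v ! i \<in> nodes I"
      using nth_mem[OF that] set_ports[OF v] neighbors_subset[of v] by blast
    then show ?thesis
      using that by (simp add: ms_def phase_at_Suc_0)
  qed
  have len: "length ms = length (ports I v)"
    by (simp add: ms_def)
  have step: "phase_at f I 2 v = step f (Counted (degree I v) (inlabel I v) (num_leaves I v)) ms"
    using phase_at_Suc_0[OF v] by (simp add: numeral_2_eq_2 ms_def phase_at.simps(2))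
  have hp: "heavy_ports f (num_leaves I v) ms =
      {i. i < length (ports I v) \<and> ports I v ! i \<in> heavy_neighbors f I v}"
    unfolding heavy_ports_def heavy_neighbors_def len
    using ms nth_mem[of _ "ports I v"] set_ports[OF v] by auto
  have "(\<exists>w\<in>set (ports I v). f (num_leaves I v) \<le> num_leaves I w) \<longleftrightarrow>
      (\<exists>i<length (ports I v). f (num_leaves I v) \<le> num_leaves I (ports I v ! i))"
    by (metis in_set_conv_nth)
  then have "(\<exists>w\<in>neighbors I v. \<not> num_leaves I w < f (num_leaves I v)) \<longleftrightarrow>
      heavy_ports f (num_leaves I v) ms \<noteq> {}"
    using nth_mem[of _ "ports I v"] set_ports[OF v] unfolding hp heavy_neighbors_def not_less by blast
  then have bal: "balanced f I v \<longleftrightarrow> degree I v = 1 \<or> heavy_ports f (num_leaves I v) ms = {}"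
    unfolding balanced_def by blast
  show ?thesis
  proof (cases "balanced f I v")
    case True
    then show ?thesis using bal by (simp add: step)
  next
    case False
    then have ne: "heavy_ports f (num_leaves I v) ms \<noteq> {}" "degree I v \<noteq> 1"
      using bal by auto
    then have "(LEAST i. i \<in> heavy_ports f (num_leaves I v) ms) \<in> heavy_ports f (num_leaves I v) ms"
      using LeastI_ex[of "\<lambda>i. i \<in> heavy_ports f (num_leaves I v) ms"] by auto
    then show ?thesis using False ne by (auto simp: step hp)
  qed
qed

lemma phase_at_balanced:
  assumes "v \<in> nodes I" "balanced f I v"
  shows "phase_at f I (2 + t) v = Done (inlabel I v)"
  using phase_at_2[OF assms(1)] assms(2) by (auto intro: phase_at_Done_mono[of _ _ 2])

text \<open>The port is fixed in round two, so from then on the phase of \<open>v\<close> mirrors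
  that of one heavy neighbor with a delay of one round.\<close>

lemma phase_at_unbalanced:
  assumes "v \<in> nodes I" "\<not> balanced f I v"
  obtains w where "w \<in> heavy_neighbors f I v"
    "\<And>t x. phase_at f I (3 + t) v = Done x \<longleftrightarrow> phase_at f I (2 + t) w = Done x"
proof -
  obtain i where i: "i < length (ports I v)" "ports I v ! i \<in> heavy_neighbors f I v"
      "phase_at f I 2 v = Waiting i"
    using phase_at_2[OF assms(1)] assms(2) by auto
  define w where "w = ports I v ! i"
  have eq: "phase_at f I (3 + t) v = (case phase_at f I (2 + t) w of Done y \<Rightarrow> Done y | _ \<Rightarrow> Waiting i)"
    for t
  proof (induction t)
    case 0
    then show ?case
      using i by (simp add: numeral_3_eq_3 numeral_2_eq_2 w_def phase_at.simps(2))
  next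
    case (Suc t)
    have "phase_at f I (3 + Suc t) v =
        step f (phase_at f I (3 + t) v) (map (phase_at f I (3 + t)) (ports I v))"
      unfolding add_Suc_right phase_at.simps(2) ..
    also have "\<dots> = (case phase_at f I (2 + Suc t) w of Done y \<Rightarrow> Done y | _ \<Rightarrow> Waiting i)"
    \<comment> \<open>If \<open>w\<close> has decided, \<open>v\<close> already carries the label
      and both keep it; otherwise \<open>v\<close> is still waiting and reads the current phase of
      \<open>w\<close>.\<close>
    proof (cases "\<exists>y. phase_at f I (2 + t) w = Done y")
      case True
      then obtain y where "phase_at f I (2 + t) w = Done y" by auto
      moreover from this have "phase_at f I (2 + Suc t) w = Done y"
        by (rule phase_at_Done_mono) simp
      ultimately show ?thesis by (simp only: Suc step.simps phase.case)
    next
      case False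
      then have "phase_at f I (3 + t) v = Waiting i"
        unfolding Suc by (auto split: phase.split)
      moreover have "map (phase_at f I (3 + t)) (ports I v) ! i = phase_at f I (2 + Suc t) w"
        using i(1) by (simp add: w_def numeral_3_eq_3 numeral_2_eq_2)
      ultimately show ?thesis by (simp only: step.simps)
    qed
    finally show ?case .
  qed
  show ?thesis
    by (rule that[of w]) (use i in \<open>auto simp: eq w_def split: phase.split\<close>)
qed

text \<open>A leaf has a single neighbor, so the sets of leaves counted at distinct nodes are
  disjoint.\<close>

lemma sum_num_leaves_le:
  assumes "W \<subseteq> nodes I"
  shows "(\<Sum>w\<in>W. num_leaves I w) \<le> card (nodes I)"
proof -
  define L where "L w = {u \<in> neighbors I w. degree I u = 1}" for w
  have sym: "sym (edges I)"
    using valid by (simp add: valid_network_def simple_connected_graph_def)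
  have fin: "finite W" "\<And>w. finite (L w)"
    using finite_subset[OF assms finite_nodes] finite_subset[OF neighbors_subset finite_nodes]
    by (simp_all add: L_def)
  have disj: "L w \<inter> L w' = {}" if "w \<noteq> w'" for w w'
  proof (rule ccontr)
    assume "L w \<inter> L w' \<noteq> {}"
    then obtain u where u: "w \<in> neighbors I u" "w' \<in> neighbors I u" "card (neighbors I u) = 1"
      using sym by (auto simp: L_def degree_def neighbors_def dest: symD)
    then show False using that by (auto simp: card_1_singleton_iff)
  qed
  have "(\<Sum>w\<in>W. num_leaves I w) = (\<Sum>w\<in>W. card (L w))"
    by (simp add: num_leaves_def L_def)
  also have "\<dots> = card (\<Union>w\<in>W. L w)"
    using fin disj by (subst card_UN_disjoint) auto
  also have "\<dots> \<le> card (nodes I)"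
    using finite_nodes neighbors_subset by (intro card_mono) (auto simp: L_def)
  finally show ?thesis .
qed

end

section \<open>Running time of forwarding\<close>

text \<open>\<open>W\<close> collects the nodes of the chain starting at \<open>v\<close>. The lower
  bound on leaf numbers in \<open>W\<close> is the invariant that keeps the predecessor, which has
  strictly fewer leaves, out of \<open>W\<close>, so that no node is counted twice.\<close>

lemma waiting_chain:
  assumes "valid_network N I" "strict_mono b" "v \<in> nodes I"
    and "\<And>x. phase_at (next_level b) I (2 + t) v \<noteq> Done x" "b j \<le> num_leaves I v"
  shows "\<exists>W \<subseteq> nodes I. (\<forall>w\<in>W. num_leaves I v \<le> num_leaves I w) \<and>
           (\<Sum>i\<le>t. b (j + i)) \<le> (\<Sum>w\<in>W. num_leaves I w)"
  using assms(3-)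
proof (induction t arbitrary: v j)
  case 0
  then show ?case by (intro exI[of _ "{v}"]) auto
next
  case (Suc t)
  let ?f = "next_level b"
  have "\<not> balanced ?f I v"
    using phase_at_balanced[OF assms(1) Suc.prems(1)] Suc.prems(2) by blast
  then obtain w where w: "w \<in> heavy_neighbors ?f I v"
      "\<And>t x. phase_at ?f I (3 + t) v = Done x \<longleftrightarrow> phase_at ?f I (2 + t) w = Done x"
    using phase_at_unbalanced[OF assms(1) Suc.prems(1)] by blast
  have wn: "w \<in> nodes I" and lw: "?f (num_leaves I v) \<le> num_leaves I w"
    using w(1) neighbors_subset[OF assms(1)] by (auto simp: heavy_neighbors_def)
  have gt: "num_leaves I v < num_leaves I w"
    using lw next_level_gt[OF assms(2)] by (meson order_less_le_trans)
  have level: "b (Suc j) \<le> num_leaves I w"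
    using next_level_ge[OF assms(2) Suc.prems(3)] lw by simp
  have waiting: "phase_at ?f I (2 + t) w \<noteq> Done x" for x
    using w(2)[of t x] Suc.prems(2)[of x] by (simp add: numeral_3_eq_3)
  from Suc.IH[OF wn waiting level]
  obtain W where W: "W \<subseteq> nodes I" "\<forall>u\<in>W. num_leaves I w \<le> num_leaves I u"
      "(\<Sum>i\<le>t. b (Suc j + i)) \<le> (\<Sum>u\<in>W. num_leaves I u)"
    by (elim exE conjE)
  have fin: "finite W" and nin: "v \<notin> W"
    using finite_subset[OF W(1) finite_nodes[OF assms(1)]] W(2) gt by auto
  have "(\<Sum>i\<le>Suc t. b (j + i)) = b j + (\<Sum>i\<le>t. b (Suc j + i))"
    by (subst sum.atMost_Suc_shift) simp
  also have "\<dots> \<le> (\<Sum>u\<in>insert v W. num_leaves I u)"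
    using W(3) Suc.prems(3) fin nin by simp
  finally have "(\<Sum>i\<le>Suc t. b (j + i)) \<le> (\<Sum>u\<in>insert v W. num_leaves I u)" .
  moreover have "\<forall>u\<in>insert v W. num_leaves I v \<le> num_leaves I u"
    using W(2) gt by auto
  moreover have "insert v W \<subseteq> nodes I"
    using W(1) Suc.prems(1) by simp
  ultimately show ?case
    by (intro exI[of _ "insert v W"] conjI)
qed

text \<open>Since \<open>b 0 = 0\<close>, every node can start a chain at level index 0, and a chain
  with too many leaves does not fit into the network.\<close>

lemma phase_at_eventually_Done:
  assumes "valid_network N I" "strict_mono b" "b 0 = 0" "v \<in> nodes I"
    and "card (nodes I) < (\<Sum>i\<le>t. b i)"
  obtains x where "phase_at (next_level b) I (2 + t) v = Done x"
proof (rule ccontr)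
  assume "\<not> thesis"
  then have "\<And>x. phase_at (next_level b) I (2 + t) v \<noteq> Done x"
    using that by blast
  from waiting_chain[OF assms(1,2,4) this, of 0] assms(3)
  obtain W where "W \<subseteq> nodes I" "(\<Sum>i\<le>t. b i) \<le> (\<Sum>w\<in>W. num_leaves I w)"
    by (auto simp only: add_0 le0)
  with sum_num_leaves_le[OF assms(1), of W] assms(5) show False
    by linarith
qed

text \<open>A crude linear bound, enough for termination and for finiteness of the round
  complexity.\<close>

lemma sum_levels_gt:
  assumes "strict_mono (b :: nat \<Rightarrow> nat)"
  shows "n < (\<Sum>i\<le>Suc n. b i)"
proof -
  have "Suc n \<le> b (Suc n)"
    by (rule strict_mono_imp_increasing[OF assms])
  also have "\<dots> \<le> (\<Sum>i\<le>Suc n. b i)"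
    by (rule member_le_sum) auto
  finally show ?thesis by simp
qed

lemma solves_forwarding:
  assumes "strict_mono b" "b 0 = 0"
  shows "solves (next_level b) N (forwarding (next_level b))"
  unfolding solves_def
proof (intro allI ballI)
  fix n I
  assume "I \<in> instances N n"
  then have val: "valid_network (N n) I" and n: "card (nodes I) = n"
    by (auto simp: instances_def)
  let ?f = "next_level b"
  have "\<exists>x. phase_at ?f I (2 + Suc n) v = Done x" if "v \<in> nodes I" for v
    using phase_at_eventually_Done[OF val assms that] sum_levels_gt[OF assms(1), of n] n by metis
  then obtain l where l: "\<And>v. v \<in> nodes I \<Longrightarrow> phase_at ?f I (2 + Suc n) v = Done (l v)"
    by metis
  have "correct_labeling ?f I l"
    unfolding correct_labeling_def
  proof (intro ballI conjI impI)
    fix v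
    assume v: "v \<in> nodes I" and "balanced ?f I v"
    from phase_at_balanced[OF val this] l[OF v] show "l v = inlabel I v"
      by simp
  next
    fix v
    assume v: "v \<in> nodes I" and "\<not> balanced ?f I v"
    from phase_at_unbalanced[OF val this] obtain w where w: "w \<in> heavy_neighbors ?f I v"
      "\<And>t x. phase_at ?f I (3 + t) v = Done x \<longleftrightarrow> phase_at ?f I (2 + t) w = Done x"
      by blast
    then have "w \<in> nodes I"
      using neighbors_subset[OF val] by (auto simp: heavy_neighbors_def)
    \<comment> \<open>The common time \<open>2 + Suc n\<close> equals \<open>3 + n\<close>, so the
      copied label was at \<open>w\<close> one round earlier.\<close>
    moreover have "phase_at ?f I (2 + n) w = Done (l v)"
      using w(2)[of n "l v"] l[OF v] by (simp add: numeral_3_eq_3)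
    ultimately have "l v = l w"
      using l phase_at_Done_unique by blast
    with w(1) show "\<exists>w\<in>heavy_neighbors ?f I v. l v = l w" by blast
  qed
  with l outputs_forwardingI(1) show "\<exists>l. (\<forall>v\<in>nodes I. outputs (forwarding ?f) (N n) I v (l v)) \<and>
      correct_labeling ?f I l"
    by blast
qed

lemma round_complexity_le:
  assumes "strict_mono b" "b 0 = 0" "n < (\<Sum>i\<le>t. b i)"
  shows "round_complexity (next_level b) N n \<le> enat (2 + t)"
proof -
  have "rounds (forwarding (next_level b)) (N n) I \<le> enat (2 + t)" if "I \<in> instances N n" for I
    unfolding rounds_def
  proof (rule SUP_least)
    fix v
    assume v: "v \<in> nodes I"
    have "valid_network (N n) I" "card (nodes I) < (\<Sum>i\<le>t. b i)"
      using that assms(3) by (auto simp: instances_def)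
    then obtain x where "phase_at (next_level b) I (2 + t) v = Done x"
      using phase_at_eventually_Done assms(1,2) v by blast
    then show "output_round (forwarding (next_level b)) (N n) I v \<le> enat (2 + t)"
      by (rule outputs_forwardingI(2))
  qed
  then show ?thesis
    unfolding round_complexity_def using solves_forwarding[OF assms(1,2)]
    by (intro INF_lower2[of "forwarding (next_level b)"] SUP_least) auto
qed

section \<open>Caterpillars\<close>

text \<open>Information moves one edge per round. Any \<open>d\<close> that changes by at most one
  along edges and vanishes where the inputs differ can replace the graph distance.\<close>

lemma state_eq_of_far:
  assumes "ident J = ident I" "edges J = edges I" "ports J = ports I"
    and lipschitz: "\<And>v w. w \<in> set (ports I v) \<Longrightarrow> d v \<le> Suc (d w)"
    and inlabel: "\<And>v. d v > 0 \<Longrightarrow> inlabel J v = inlabel I v"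
    and "t < d v"
  shows "state A N J t v = state A N I t v"
  using \<open>t < d v\<close>
proof (induction t arbitrary: v)
  case 0
  then show ?case
    using assms(1,2) inlabel by (simp add: degree_def neighbors_def)
next
  case (Suc t)
  have "state A N J t w = state A N I t w" if "w \<in> set (ports I v)" for w
    using Suc.prems lipschitz[OF that] by (intro Suc.IH) simp
  moreover have "state A N J t v = state A N I t v"
    using Suc.prems by (intro Suc.IH) simp
  ultimately show ?case
    using assms(3) by (simp add: port_to_def cong: map_cong)
qed

lemma outputs_earlier:
  assumes "outputs A N I v x" "\<And>t. t < k \<Longrightarrow> state A N J t v = state A N I t v"
    and "output_round A N I v < enat k" "outputs A N J v y"
  shows "x = y"
proof -
  obtain t where t: "output_round A N I v = enat t" "out A (state A N I t v) = Some x"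
    using assms(1) by (auto simp: outputs_def)
  obtain s where s: "output_round A N J v = enat s" "out A (state A N J s v) = Some y"
    using assms(4) by (auto simp: outputs_def)
  have "t < k" using t(1) assms(3) by simp
  have "output_round A N J v \<le> enat t"
    unfolding output_round_def
    by (rule INF_lower) (use t(2) assms(2)[OF \<open>t < k\<close>] in simp)
  then have "s \<le> t" using s(1) by simp
  \<comment> \<open>Both first decision rounds precede \<open>k\<close>, where the runs agree, so
    each bounds the other.\<close>
  then have "output_round A N I v \<le> enat s"
    unfolding output_round_def
    by (intro INF_lower) (use s(2) assms(2)[of s] \<open>t < k\<close> in simp)
  then have "s = t" using \<open>s \<le> t\<close> t(1) by simp
  then show ?thesis
    using s(2) t(2) assms(2)[OF \<open>t < k\<close>] by simp
qed

text \<open>The size assumption pays for \<open>Suc k\<close> spine nodes and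
  \<open>b (Suc i)\<close> leaves at each spine node \<open>i\<close>; node \<open>k\<close> absorbs
  the surplus, so that exactly \<open>n\<close> nodes are used. By \<open>k_pos\<close> every spine
  node has a spine neighbor.\<close>

locale caterpillar =
  fixes b :: "nat \<Rightarrow> nat" and k n :: nat
  assumes mono: "strict_mono b" and b_0: "b 0 = 0"
    and k_pos: "0 < k" and size: "Suc k + (\<Sum>i\<le>Suc k. b i) \<le> n"
begin

definition first_leaf :: "nat \<Rightarrow> nat" where
  "first_leaf i = Suc k + (\<Sum>j\<le>i. b j)"

text \<open>
  The nodes \<open>0, \<dots>, k\<close> form the spine; node \<open>i < k\<close> carries the leaves from \<open>first_leaf i\<close>
  up to but excluding \<open>first_leaf (i + 1)\<close>, and node \<open>k\<close> carries all remaining leaves.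
\<close>
definition parent :: "nat \<Rightarrow> nat" where
  "parent v = (if v \<le> k then v - 1 else (LEAST i. k \<le> i \<or> v < first_leaf (Suc i)))"

text \<open>Node \<open>0\<close> is the root; it is excluded because \<open>parent 0 = 0\<close>
  would give a loop.\<close>

definition tree_edges :: "(nat \<times> nat) set" where
  "tree_edges = {(v, parent v) | v. 0 < v \<and> v < n} \<union> {(parent v, v) | v. 0 < v \<and> v < n}"

definition net :: "bool \<Rightarrow> network" where
  "net x = \<lparr>nodes = {..<n}, edges = tree_edges, ident = (\<lambda>v. v), inlabel = (\<lambda>v. v = k \<and> x),
     ports = (\<lambda>v. sorted_list_of_set {w. (v, w) \<in> tree_edges})\<rparr>"

lemma nodes_net [simp]: "nodes (net x) = {..<n}"
  by (simp add: net_def)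

lemma k_less: "k < n"
  using size by simp

lemma b_pos: "0 < i \<Longrightarrow> 0 < b i"
  using strict_mono_less[OF mono, of 0 i] b_0 by simp

lemma first_leaf_mono: "i \<le> j \<Longrightarrow> first_leaf i \<le> first_leaf j"
  unfolding first_leaf_def by (intro add_left_mono sum_mono2) auto

lemma first_leaf_0: "first_leaf 0 = Suc k"
  by (simp add: first_leaf_def b_0)

lemma first_leaf_Suc: "first_leaf (Suc i) = first_leaf i + b (Suc i)"
  by (simp add: first_leaf_def)

lemma first_leaf_less_n: "i \<le> k \<Longrightarrow> first_leaf i < n"
  using first_leaf_mono[of i k] size b_pos[of "Suc k"] by (simp add: first_leaf_def)

lemma parent_spine: "v \<le> k \<Longrightarrow> parent v = v - 1"
  by (simp add: parent_def)

lemma parent_leaf_le: "k < v \<Longrightarrow> parent v \<le> k"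
  by (simp add: parent_def Least_le)

lemma parent_less: "0 < v \<Longrightarrow> parent v < v"
  using parent_leaf_le[of v] parent_spine[of v] by (cases "v \<le> k") auto

text \<open>Turns the \<open>LEAST\<close> into intervals of leaf names, from which the leaf numbers
  can be read off.\<close>

lemma parent_leaf_eq_iff:
  assumes "k < v" "i \<le> k"
  shows "parent v = i \<longleftrightarrow> first_leaf i \<le> v \<and> (i = k \<or> v < first_leaf (Suc i))"
proof -
  let ?P = "\<lambda>i. k \<le> i \<or> v < first_leaf (Suc i)"
  have p: "parent v = (LEAST i. ?P i)"
    using assms by (simp add: parent_def)
  have P: "?P (parent v)"
    unfolding p by (rule LeastI[of ?P k]) simp
  have lower: "first_leaf (parent v) \<le> v"
  proof (cases "parent v")
    case 0
    then show ?thesis using assms by (simp add: first_leaf_0)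
  next
    case (Suc j)
    then have "\<not> ?P j"
      using not_less_Least[of j ?P] p by simp
    then show ?thesis using Suc by simp
  qed
  show ?thesis
  proof
    assume "parent v = i"
    then show "first_leaf i \<le> v \<and> (i = k \<or> v < first_leaf (Suc i))"
      using P lower assms(2) by auto
  next
    assume i: "first_leaf i \<le> v \<and> (i = k \<or> v < first_leaf (Suc i))"
    then have "parent v \<le> i"
      unfolding p by (intro Least_le) auto
    moreover have "\<not> parent v < i"
    proof
      assume "parent v < i"
      then have "v < first_leaf (Suc (parent v))"
        using P assms(2) by auto
      also have "\<dots> \<le> first_leaf i"
        using \<open>parent v < i\<close> by (intro first_leaf_mono) simp
      finally show False using i by simp
    qed
    ultimately show "parent v = i" by simp
  qed
qed

lemma neighbors_net:
  "neighbors (net x) v = {w. 0 < w \<and> w < n \<and> parent w = v} \<union> (if 0 < v \<and> v < n then {parent v} else {})"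
  by (auto simp: neighbors_def net_def tree_edges_def)

lemma finite_neighbors_net: "finite (neighbors (net x) v)"
  by (simp add: neighbors_net)

text \<open>Parents are smaller than their children, so every node reaches the root by strong
  induction, which gives connectivity.\<close>

lemma valid_net:
  assumes "n \<le> N"
  shows "valid_network N (net x)"
proof -
  have sub: "tree_edges \<subseteq> {..<n} \<times> {..<n}"
    using parent_less by (auto simp: tree_edges_def intro: less_trans)
  have sym: "sym tree_edges"
    by (auto simp: sym_def tree_edges_def)
  have root: "(v, 0) \<in> tree_edges\<^sup>*" if "v < n" for v
    using that
  proof (induction v rule: less_induct)
    case (less v)
    show ?case
    proof (cases "v = 0")
      case False
      then have "(v, parent v) \<in> tree_edges" "(parent v, 0) \<in> tree_edges\<^sup>*"
        using less parent_less[of v] by (auto simp: tree_edges_def)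
      then show ?thesis by (rule converse_rtrancl_into_rtrancl)
    qed simp
  qed
  have "(u, v) \<in> tree_edges\<^sup>*" if "u < n" "v < n" for u v
    using root[OF that(1)] root[OF that(2)] sym_rtrancl[OF sym]
    by (meson rtrancl_trans symD)
  moreover have "irrefl tree_edges"
    using parent_less by (auto simp: irrefl_def tree_edges_def) (metis less_irrefl)+
  ultimately have "simple_connected_graph (net x)"
    using sub sym k_less by (auto simp: simple_connected_graph_def net_def)
  moreover have "finite {w. (v, w) \<in> tree_edges}" for v
    using finite_neighbors_net[of x v] by (simp add: neighbors_def net_def)
  ultimately show ?thesis
    using assms by (auto simp: valid_network_def net_def neighbors_def)
qed

lemma net_in_instances: "n \<le> N n \<Longrightarrow> net x \<in> instances N n"
  using valid_net by (auto simp: instances_def net_def)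

lemma neighbors_leaf:
  assumes "k < v" "v < n"
  shows "neighbors (net x) v = {parent v}"
proof -
  have "parent w \<noteq> v" if "0 < w" for w
    using parent_leaf_le[of w] parent_spine[of w] assms by (cases "k < w") auto
  then show ?thesis using assms by (auto simp: neighbors_net)
qed

lemma neighbors_spine:
  assumes "v \<le> k"
  shows "neighbors (net x) v =
    {w. k < w \<and> w < n \<and> parent w = v} \<union> {w. w \<le> k \<and> (Suc w = v \<or> w = Suc v)}"
proof -
  have "0 < w \<and> w < n \<and> parent w = v \<longleftrightarrow> w = Suc v" if "w \<le> k" for w
    using that k_less by (auto simp: parent_spine)
  then have "{w. 0 < w \<and> w < n \<and> parent w = v} =
      {w. k < w \<and> w < n \<and> parent w = v} \<union> {w. w \<le> k \<and> w = Suc v}"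
    by (auto simp: not_less) (metis leI)+
  moreover have "(if 0 < v \<and> v < n then {parent v} else {}) = {w. w \<le> k \<and> Suc w = v}"
    using assms k_less by (auto simp: parent_spine)
  ultimately show ?thesis unfolding neighbors_net by blast
qed

text \<open>Levels of positive index are positive, so every spine node has a leaf and, with a spine
  neighbor, degree at least 2.\<close>

lemma first_leaf_child:
  assumes "v \<le> k"
  shows "k < first_leaf v \<and> first_leaf v < n \<and> parent (first_leaf v) = v"
proof -
  have *: "k < first_leaf v" by (simp add: first_leaf_def)
  have "parent (first_leaf v) = v"
    using assms b_pos[of "Suc v"] by (subst parent_leaf_eq_iff[OF *]) (auto simp: first_leaf_Suc)
  then show ?thesis using * first_leaf_less_n[OF assms] by simp
qed

lemma degree_eq_1_iff:
  assumes "v < n"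
  shows "degree (net x) v = 1 \<longleftrightarrow> k < v"
proof (cases "k < v")
  case True
  then show ?thesis using assms by (simp add: degree_def neighbors_leaf)
next
  case False
  then have v: "v \<le> k" by simp
  define u where "u = (if v < k then Suc v else v - 1)"
  have "{u, first_leaf v} \<subseteq> neighbors (net x) v"
    using first_leaf_child[OF v] k_pos v unfolding neighbors_spine[OF v] u_def by auto
  moreover have "u \<noteq> first_leaf v"
    using first_leaf_child[OF v] v by (auto simp: u_def)
  ultimately have "2 \<le> degree (net x) v"
    using card_mono[OF finite_neighbors_net, of "{u, first_leaf v}" x v] by (simp add: degree_def)
  then show ?thesis using False by simp
qed

lemma num_leaves_eq: "num_leaves (net x) v = card {w \<in> neighbors (net x) v. k < w}"
proof -
  have "degree (net x) w = 1 \<longleftrightarrow> k < w" if "w \<in> neighbors (net x) v" for w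
  proof (rule degree_eq_1_iff)
    show "w < n"
      using that parent_less[of v] by (auto simp: neighbors_net split: if_splits)
  qed
  then show ?thesis
    unfolding num_leaves_def by (intro arg_cong[where f = card]) auto
qed

lemma num_leaves_leaf:
  assumes "k < v" "v < n"
  shows "num_leaves (net x) v = 0"
proof -
  have "{w \<in> neighbors (net x) v. k < w} = {}"
    using parent_leaf_le[OF assms(1)] by (auto simp: neighbors_leaf[OF assms])
  then show ?thesis by (simp only: num_leaves_eq card.empty)
qed

lemma num_leaves_spine:
  assumes "v < k"
  shows "num_leaves (net x) v = b (Suc v)"
proof -
  have "w \<in> neighbors (net x) v \<and> k < w \<longleftrightarrow> w \<in> {first_leaf v..<first_leaf (Suc v)}" for w
    using assms first_leaf_less_n[of "Suc v"] parent_leaf_eq_iff[of w v] first_leaf_mono[of 0 v]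
    by (auto simp: neighbors_spine first_leaf_0)
  then have "{w \<in> neighbors (net x) v. k < w} = {first_leaf v..<first_leaf (Suc v)}" by blast
  then show ?thesis by (simp add: num_leaves_eq first_leaf_Suc)
qed

lemma num_leaves_end: "b (Suc k) \<le> num_leaves (net x) k"
proof -
  have "{w \<in> neighbors (net x) k. k < w} = {first_leaf k..<n}"
    using parent_leaf_eq_iff[of _ k] first_leaf_mono[of 0 k]
    by (auto simp: neighbors_spine first_leaf_0)
  then show ?thesis using size by (simp add: num_leaves_eq first_leaf_def)
qed

text \<open>Node \<open>k\<close> is balanced, as its spine neighbor has no more leaves and its
  other neighbors are leaves. Going down the spine, the only heavy neighbor of \<open>v\<close> is
  \<open>Suc v\<close>, so the input of node \<open>k\<close> is forced on all spine nodes.\<close>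

lemma labels_of_spine:
  assumes "correct_labeling (next_level b) (net x) l" "v \<le> k"
  shows "l v = x"
  using assms(2)
proof (induction v rule: inc_induct)
  case base
  have "num_leaves (net x) w < next_level b (num_leaves (net x) k)" if "w \<in> neighbors (net x) k" for w
  proof (cases "k < w")
    case True
    with that have "num_leaves (net x) w = 0"
      by (intro num_leaves_leaf) (auto simp: neighbors_spine)
    then show ?thesis
      using next_level_gt[OF mono, of "num_leaves (net x) k"] by simp
  next
    case False
    with that have "Suc w = k" by (auto simp: neighbors_spine)
    then have "num_leaves (net x) w = b k" by (auto simp: num_leaves_spine)
    also have "\<dots> \<le> b (Suc k)" using mono by (simp add: strict_mono_less_eq)
    also have "\<dots> \<le> num_leaves (net x) k" by (rule num_leaves_end)
    also have "\<dots> < next_level b (num_leaves (net x) k)" by (rule next_level_gt[OF mono])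
    finally show ?thesis .
  qed
  then have "balanced (next_level b) (net x) k"
    by (simp add: balanced_def)
  then have "l k = inlabel (net x) k"
    using assms(1) k_less by (auto simp: correct_labeling_def net_def)
  then show ?case by (simp add: net_def)
next
  case (step v)
  \<comment> \<open>The threshold at \<open>v\<close> is exactly the level assigned to
    \<open>Suc v\<close>.\<close>
  have lv: "next_level b (num_leaves (net x) v) = b (Suc (Suc v))"
    using step by (simp add: num_leaves_spine next_level_apply[OF mono])
  have "b (Suc (Suc v)) \<le> num_leaves (net x) (Suc v)"
    using num_leaves_spine[of "Suc v"] num_leaves_end[of x] step by (cases "Suc v = k") auto
  moreover have "Suc v \<in> neighbors (net x) v"
    using step by (simp add: neighbors_spine)
  moreover have "degree (net x) v \<noteq> 1"
    using step k_less degree_eq_1_iff[of v x] by simp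
  ultimately have "\<not> balanced (next_level b) (net x) v"
    unfolding balanced_def lv using not_le by blast
  moreover have "v \<in> nodes (net x)"
    using step k_less by simp
  ultimately obtain w where w: "w \<in> heavy_neighbors (next_level b) (net x) v" "l v = l w"
    using assms(1) unfolding correct_labeling_def by blast
  then have nb: "w \<in> neighbors (net x) v" and hv: "b (Suc (Suc v)) \<le> num_leaves (net x) w"
    by (auto simp: heavy_neighbors_def lv)
  have "\<not> k < w"
  proof
    assume "k < w"
    with nb step have "num_leaves (net x) w = 0"
      by (intro num_leaves_leaf) (auto simp: neighbors_spine)
    then show False using hv b_pos[of "Suc (Suc v)"] by simp
  qed
  moreover have "Suc w \<noteq> v"
  proof
    assume "Suc w = v"
    then have "num_leaves (net x) w = b v" using step by (auto simp: num_leaves_spine)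
    then show False using hv strict_mono_less_eq[OF mono, of "Suc (Suc v)" v] by simp
  qed
  ultimately have "w = Suc v"
    using nb step by (auto simp: neighbors_spine)
  then show ?case using w(2) step.IH by simp
qed

text \<open>The distance to node \<open>k\<close>, whose input label is the only one that depends on \<open>x\<close>.\<close>
definition dist_end :: "nat \<Rightarrow> nat" where
  "dist_end v = (if v \<le> k then k - v else Suc (k - parent v))"

lemma state_net_eq:
  assumes "t < k"
  shows "state A N (net x) t 0 = state A N (net y) t 0"
proof (rule state_eq_of_far[where d = dist_end])
  fix v w
  assume "w \<in> set (ports (net y) v)"
  then have "w \<in> neighbors (net y) v"
    using finite_neighbors_net[of y v] by (simp add: net_def neighbors_def)
  moreover have "v < n"
    using calculation parent_less by (auto simp: neighbors_net split: if_splits intro: less_trans)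
  ultimately show "dist_end v \<le> Suc (dist_end w)"
    using parent_leaf_le by (cases "k < v") (auto simp: dist_end_def neighbors_leaf neighbors_spine)
qed (use assms in \<open>auto simp: net_def dist_end_def\<close>)

lemma rounds_net_ge:
  assumes "solves (next_level b) N A" "n \<le> N n"
  shows "\<exists>I\<in>instances N n. enat k \<le> rounds A (N n) I"
proof -
  have out: "outputs A (N n) (net x) 0 x" for x
  proof -
    obtain l where l: "\<And>v. v < n \<Longrightarrow> outputs A (N n) (net x) v (l v)"
        "correct_labeling (next_level b) (net x) l"
      using assms(1) net_in_instances[where N = N and x = x, OF assms(2)]
      unfolding solves_def by (metis lessThan_iff nodes_net)
    then show ?thesis
      using l(1)[of 0] labels_of_spine[OF l(2), of 0] k_less by simp
  qed
  \<comment> \<open>Deciding before round \<open>k\<close> would give the same label on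
    \<open>net False\<close>, although the required labels are \<open>True\<close> and
    \<open>False\<close>.\<close>
  have "\<not> output_round A (N n) (net True) 0 < enat k"
    using outputs_earlier[OF out state_net_eq _ out] by blast
  moreover have "output_round A (N n) (net True) 0 \<le> rounds A (N n) (net True)"
    unfolding rounds_def by (rule SUP_upper) (use k_less in \<open>simp add: net_def\<close>)
  ultimately show ?thesis
    using net_in_instances[where N = N, OF assms(2)] by (meson not_le order_trans)
qed

end

lemma round_complexity_ge:
  assumes "strict_mono b" "b 0 = 0" "Suc k + (\<Sum>i\<le>Suc k. b i) \<le> n" "n \<le> N n"
  shows "enat k \<le> round_complexity (next_level b) N n"
proof (cases "k = 0")
  case False
  then interpret caterpillar b k n
    using assms by unfold_locales auto
  show ?thesis
    unfolding round_complexity_def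
  proof (rule INF_greatest)
    fix A
    assume "A \<in> {A. solves (next_level b) N A}"
    then obtain I where "I \<in> instances N n" "enat k \<le> rounds A (N n) I"
      using rounds_net_ge[where N = N, OF _ assms(4)] by blast
    then show "enat k \<le> (SUP I\<in>instances N n. rounds A (N n) I)"
      by (rule SUP_upper2)
  qed
qed (simp add: zero_enat_def[symmetric])

section \<open>Choosing the growth of the levels\<close>

text \<open>Networks disappear here: only partial sums of \<open>b\<close> have to be compared with
  \<open>g\<close>. The constants do not depend on \<open>N\<close>, of which the lower bound uses
  just \<open>n \<le> N n\<close>.\<close>

lemma has_round_complexity_ThetaI:
  assumes "strict_mono b" "b 0 = 0" "0 < c"
    and nonneg: "eventually (\<lambda>n. 0 \<le> g n) sequentially"
    and upper: "eventually (\<lambda>n. \<exists>t. n < (\<Sum>i\<le>t. b i) \<and> real (2 + t) \<le> C * g n) sequentially"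
    and lower: "eventually (\<lambda>n. \<exists>k. Suc k + (\<Sum>i\<le>Suc k. b i) \<le> n \<and> c * g n \<le> real k) sequentially"
  shows "has_round_complexity_Theta (next_level b) g"
  unfolding has_round_complexity_Theta_def
proof (intro allI impI conjI)
  fix N n
  show "round_complexity (next_level b) N n \<noteq> \<infinity>"
    using round_complexity_le[OF assms(1,2) sum_levels_gt[OF assms(1)], where N = N and n = n]
    by (auto dest: enat_ile)
next
  fix N
  assume N: "poly_id_bound N"
  let ?R = "\<lambda>n. real (the_enat (round_complexity (next_level b) N n))"
  have "eventually (\<lambda>n. norm (?R n) \<le> C * norm (g n)) sequentially"
    using upper nonneg
  proof eventually_elim
    case (elim n)
    then obtain t where t: "n < (\<Sum>i\<le>t. b i)" "real (2 + t) \<le> C * g n" by blast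
    obtain r where r: "round_complexity (next_level b) N n = enat r" "r \<le> 2 + t"
      using round_complexity_le[OF assms(1,2) t(1), where N = N] enat_ile by fastforce
    show ?case
      using r t(2) elim(2) by simp
  qed
  moreover have "eventually (\<lambda>n. c * norm (g n) \<le> norm (?R n)) sequentially"
    using lower nonneg eventually_ge_at_top[of 1]
  proof eventually_elim
    case (elim n)
    then obtain k where k: "Suc k + (\<Sum>i\<le>Suc k. b i) \<le> n" "c * g n \<le> real k" by blast
    have "n \<le> N n" using N elim(3) by (simp add: poly_id_bound_def)
    obtain r where r: "round_complexity (next_level b) N n = enat r"
      using round_complexity_le[OF assms(1,2) sum_levels_gt[OF assms(1)], where N = N and n = n]
        enat_ile by blast
    moreover have "k \<le> r"
      using round_complexity_ge[where N = N, OF assms(1,2) k(1) \<open>n \<le> N n\<close>] r by simp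
    ultimately show ?case
      using k(2) elim(2) by simp
  qed
  ultimately show "?R \<in> \<Theta>(g)"
    using \<open>0 < c\<close> by (intro bigthetaI bigoI landau_omega.bigI)
qed

text \<open>The summand \<open>i\<close> makes the sequence strictly increasing for every nondecreasing \<open>h\<close>.\<close>
definition levels :: "(real \<Rightarrow> real) \<Rightarrow> nat \<Rightarrow> nat" where
  "levels h i = i + nat \<lfloor>h (real i)\<rfloor>"

lemma levels_eq: "h (real i) < 1 \<Longrightarrow> levels h i = i"
  by (simp add: levels_def)

text \<open>The condition \<open>small\<close> makes the rounded values of \<open>h\<close> vanish
  at 0, 1 and 2. The first levels are then 0, 1, 2, which yields the prescribed values of
  \<open>next_level\<close> at 0 and 1.\<close>

locale level_growth =
  fixes h :: "real \<Rightarrow> real"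
  assumes mono: "\<And>x y. 0 \<le> x \<Longrightarrow> x \<le> y \<Longrightarrow> h x \<le> h y"
    and nonneg: "\<And>x. 0 \<le> x \<Longrightarrow> 0 \<le> h x"
    and small: "h 2 < 1"
begin

lemma strict_mono_levels: "strict_mono (levels h)"
proof (simp only: strict_mono_Suc_iff, rule allI)
  fix i
  have "nat \<lfloor>h (real i)\<rfloor> \<le> nat \<lfloor>h (real (Suc i))\<rfloor>"
    by (intro nat_mono floor_mono mono) auto
  then show "levels h i < levels h (Suc i)" by (simp add: levels_def)
qed

lemma levels_small: "levels h 0 = 0" "levels h 1 = 1" "levels h 2 = 2"
proof -
  have "h (real i) < 1" if "i \<le> 2" for i
    using mono[of "real i" 2] small that by simp
  from this[of 0] this[of 1] this[of 2]
  show "levels h 0 = 0" "levels h 1 = 1" "levels h 2 = 2"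
    by (simp_all add: levels_eq)
qed

lemma next_level_levels_small: "next_level (levels h) 0 = 1" "next_level (levels h) 1 = 2"
  using next_level_apply[OF strict_mono_levels, of 0] next_level_apply[OF strict_mono_levels, of 1]
    levels_small by (simp_all add: numeral_2_eq_2)

text \<open>The summand \<open>i\<close> is at least 1 and makes up for rounding down.\<close>

lemma levels_ge: "0 < i \<Longrightarrow> h (real i) \<le> real (levels h i)"
  using nonneg[of "real i"] by (simp add: levels_def) linarith

lemma levels_le: "real (levels h i) \<le> real i + h (real i)"
  using nonneg[of "real i"] by (simp add: levels_def)

lemma sum_levels_le:
  assumes "real k \<le> x"
  shows "(\<Sum>i\<le>k. real (levels h i)) \<le> (x + 1) * (x + h x)"
proof -
  have "(\<Sum>i\<le>k. real (levels h i)) \<le> (\<Sum>i\<le>k. x + h x)"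
  proof (rule sum_mono)
    fix i
    assume "i \<in> {..k}"
    then have "real i \<le> x" using assms by simp
    then show "real (levels h i) \<le> x + h x"
      using levels_le[of i] mono[of "real i" x] by simp
  qed
  also have "\<dots> = (real k + 1) * (x + h x)" by simp
  also have "\<dots> \<le> (x + 1) * (x + h x)"
    using assms nonneg[of x] by (intro mult_right_mono) auto
  finally show ?thesis .
qed

text \<open>Half of the summands have an index of at least \<open>t / 2\<close>.\<close>
lemma sum_levels_ge:
  assumes "0 < x" "2 * x \<le> real t"
  shows "x * h x \<le> (\<Sum>i\<le>t. real (levels h i))"
proof -
  let ?T = "{t - t div 2..t}"
  have half: "x \<le> real i" if "i \<in> ?T" for i
  proof -
    have "t \<le> 2 * i" using that by auto
    then show ?thesis using assms(2) by linarith
  qed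
  have "x \<le> real (t div 2 + 1)"
    using assms(2) by linarith
  then have "x * h x \<le> real (t div 2 + 1) * h x"
    using nonneg[of x] assms(1) by (intro mult_right_mono) auto
  also have "\<dots> = (\<Sum>i\<in>?T. h x)" by simp
  also have "\<dots> \<le> (\<Sum>i\<in>?T. real (levels h i))"
  proof (rule sum_mono)
    fix i
    assume "i \<in> ?T"
    then have "x \<le> real i" by (rule half)
    then show "h x \<le> real (levels h i)"
      using mono[of x "real i"] levels_ge[of i] assms(1) by (cases "i = 0") auto
  qed
  also have "\<dots> \<le> (\<Sum>i\<le>t. real (levels h i))"
    by (rule sum_mono2) auto
  finally show ?thesis .
qed

text \<open>Only real inequalities remain. The caterpillar gets a spine of about
  \<open>c * g n\<close> nodes, and forwarding gets about \<open>2 * C * g n\<close> rounds.\<close>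

lemma has_round_complexity_Theta_levels:
  assumes g: "filterlim g at_top sequentially" and "0 < c" "0 < C"
    and lower: "eventually (\<lambda>n. c * g n + (c * g n + 1) * (c * g n + h (c * g n)) \<le> real n) sequentially"
    and upper: "eventually (\<lambda>n. real n < C * g n * h (C * g n)) sequentially"
  shows "has_round_complexity_Theta (next_level (levels h)) g"
proof (rule has_round_complexity_ThetaI)
  show "strict_mono (levels h)" by (rule strict_mono_levels)
  show "levels h 0 = 0" by (rule levels_small)
  show "0 < c / 2" using \<open>0 < c\<close> by simp
  show "eventually (\<lambda>n. 0 \<le> g n) sequentially"
    using g by (auto simp: filterlim_at_top)
  \<comment> \<open>This ensures \<open>2 \<le> x\<close>, so the two preparatory rounds and the
    rounding of \<open>2 * x\<close> fit into \<open>4 * x\<close>.\<close>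
  have "eventually (\<lambda>n. 2 / C \<le> g n) sequentially"
    using g by (simp add: filterlim_at_top)
  with upper show "eventually (\<lambda>n. \<exists>t. n < (\<Sum>i\<le>t. levels h i) \<and> real (2 + t) \<le> (4 * C) * g n) sequentially"
  proof eventually_elim
    case (elim n)
    define x where "x = C * g n"
    have x: "2 \<le> x" using elim(2) \<open>0 < C\<close> by (simp add: x_def field_simps)
    define t where "t = nat \<lceil>2 * x\<rceil>"
    have t: "2 * x \<le> real t" "real t < 2 * x + 1"
      using x unfolding t_def by linarith+
    have "real n < (\<Sum>i\<le>t. real (levels h i))"
      using elim(1) sum_levels_ge[of x t] x t(1) by (simp add: x_def)
    then have "n < (\<Sum>i\<le>t. levels h i)"
      by (simp only: of_nat_sum[symmetric] of_nat_less_iff)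
    moreover have "real (2 + t) \<le> 4 * x" using t(2) x by simp
    ultimately show ?case by (auto simp: x_def)
  qed
  \<comment> \<open>This ensures \<open>4 \<le> x\<close>, so that \<open>x - 2\<close>, what
    rounding leaves of \<open>k\<close>, is at least \<open>x / 2\<close>.\<close>
  have "eventually (\<lambda>n. 4 / c \<le> g n) sequentially"
    using g by (simp add: filterlim_at_top)
  with lower show "eventually (\<lambda>n. \<exists>k. Suc k + (\<Sum>i\<le>Suc k. levels h i) \<le> n \<and> c / 2 * g n \<le> real k) sequentially"
  proof eventually_elim
    case (elim n)
    define x where "x = c * g n"
    have x: "4 \<le> x" using elim(2) \<open>0 < c\<close> by (simp add: x_def field_simps)
    define k where "k = nat \<lfloor>x\<rfloor> - 1"
    have k: "real (Suc k) \<le> x" "x - 2 \<le> real k"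
      using x unfolding k_def by linarith+
    have "real (Suc k) + (\<Sum>i\<le>Suc k. real (levels h i)) \<le> real n"
      using elim(1) sum_levels_le[OF k(1)] k(1) unfolding x_def by linarith
    then have "Suc k + (\<Sum>i\<le>Suc k. levels h i) \<le> n"
      by (simp only: of_nat_sum[symmetric] of_nat_add[symmetric] of_nat_le_iff)
    moreover have "c / 2 * g n \<le> real k" using k(2) x by (simp add: x_def)
    ultimately show ?case by blast
  qed
qed

end

section \<open>The two growth rates\<close>

text \<open>Levels of order \<open>i powr (s - 1)\<close> have partial sums of order
  \<open>t powr s\<close>. The divisor 3 gives \<open>h 2 < 1\<close>, and \<open>s > 2\<close> lets
  \<open>h\<close> dominate the linear summand of \<open>levels\<close>.\<close>

lemma Theta_powr:
  assumes "s > (2::real)"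
  defines "h \<equiv> \<lambda>x. (x / 3) powr (s - 1)"
  shows "level_growth h" "has_round_complexity_Theta (next_level (levels h)) (\<lambda>n. real n powr (1 / s))"
proof -
  show growth: "level_growth h"
  proof
    show "h 2 < 1"
      using assms(1) powr_less_mono2[of "s - 1" "2 / 3" 1] by (simp add: h_def)
  qed (use assms(1) in \<open>auto simp: h_def intro: powr_mono2\<close>)
  interpret level_growth h by (rule growth)
  let ?g = "\<lambda>n. real n powr (1 / s)"
  have split: "?g n * ?g n powr (s - 1) = real n" for n
  proof -
    have "?g n * ?g n powr (s - 1) = real n powr (1 / s + 1 / s * (s - 1))"
      by (simp add: powr_powr powr_add)
    also have "1 / s + 1 / s * (s - 1) = 1"
      using assms(1) by (simp add: field_simps)
    finally show ?thesis by simp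
  qed
  have g: "filterlim ?g at_top sequentially"
    using assms(1) by real_asymp
  show "has_round_complexity_Theta (next_level (levels h)) ?g"
  \<comment> \<open>The factor 3 cancels the divisor in \<open>h\<close>, giving
    \<open>3 * n > n\<close>. With 1/4 the total is at most 1/4 + 1/2 * 5/4 = 7/8 of
    \<open>n\<close>.\<close>
  proof (rule has_round_complexity_Theta_levels[OF g, of "1 / 4" 3])
    have "eventually (\<lambda>n. 4 \<le> ?g n) sequentially"
      using g by (simp add: filterlim_at_top)
    then show "eventually (\<lambda>n. 1 / 4 * ?g n + (1 / 4 * ?g n + 1) * (1 / 4 * ?g n + h (1 / 4 * ?g n)) \<le> real n) sequentially"
    proof eventually_elim
      case (elim n)
      define y where "y = ?g n"
      have y: "4 \<le> y" using elim by (simp add: y_def)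
      have n: "y * y powr (s - 1) = real n"
        unfolding y_def by (rule split)
      have "y powr 1 \<le> y powr (s - 1)" using y assms(1) by (intro powr_mono) auto
      then have p: "y \<le> y powr (s - 1)" using y by simp
      have "h (1 / 4 * y) \<le> y powr (s - 1)"
        unfolding h_def using y assms(1) by (intro powr_mono2) auto
      then have "(1 / 4 * y + 1) * (1 / 4 * y + h (1 / 4 * y)) \<le> (1 / 2 * y) * (5 / 4 * y powr (s - 1))"
        using y p nonneg[of "1 / 4 * y"] by (intro mult_mono) auto
      moreover have "1 / 4 * y \<le> 1 / 4 * (y * y powr (s - 1))"
        using y p mult_mono[of 1 y y "y powr (s - 1)"] by simp
      ultimately have "1 / 4 * y + (1 / 4 * y + 1) * (1 / 4 * y + h (1 / 4 * y)) \<le> 7 / 8 * (y * y powr (s - 1))"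
        by (simp add: field_simps)
      then show ?case using n by (simp add: y_def)
    qed
    show "eventually (\<lambda>n. real n < 3 * ?g n * h (3 * ?g n)) sequentially"
      using eventually_gt_at_top[of 0]
    proof eventually_elim
      case (elim n)
      then show ?case using split[of n] by (simp add: h_def)
    qed
  qed auto
qed

text \<open>The divisor 10 exceeds \<open>exp 2\<close>, hence \<open>h 2 < 1\<close>. Up to this
  divisor, \<open>h\<close> maps \<open>c powr \<gamma> * ln n powr \<gamma>\<close> to
  \<open>n powr c\<close>.\<close>

lemma Theta_ln_powr:
  assumes "\<gamma> > (1::real)"
  defines "h \<equiv> \<lambda>x. exp (x powr (1 / \<gamma>)) / 10"
  shows "level_growth h" "has_round_complexity_Theta (next_level (levels h)) (\<lambda>n. ln (real n) powr \<gamma>)"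
proof -
  show growth: "level_growth h"
  proof
    have "2 powr (1 / \<gamma>) < (2::real)"
      using assms(1) powr_less_mono[of "1 / \<gamma>" 1 2] by simp
    then have "exp (2 powr (1 / \<gamma>)) < exp (2::real)" by simp
    also have "exp (2::real) = exp 1 * exp 1" by (simp flip: exp_add)
    also have "exp 1 * exp 1 \<le> (3 * 3 :: real)"
      using exp_le by (intro mult_mono) auto
    finally show "h 2 < 1" by (simp add: h_def)
  qed (use assms(1) in \<open>auto simp: h_def intro!: powr_mono2\<close>)
  interpret level_growth h by (rule growth)
  let ?g = "\<lambda>n. ln (real n) powr \<gamma>"
  have g: "filterlim ?g at_top sequentially"
    using assms(1) by real_asymp
  have h: "h (c powr \<gamma> * ?g n) = exp (c * ln (real n)) / 10" if "1 \<le> n" "0 < c" for c :: real and n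
    using that assms(1) by (simp add: h_def powr_mult[symmetric] powr_powr)
  show "has_round_complexity_Theta (next_level (levels h)) ?g"
  \<comment> \<open>The values of \<open>h\<close> become \<open>sqrt n / 10\<close> and
    \<open>n^2 / 10\<close>; polylogarithmic factors do not close the gap to
    \<open>n\<close>.\<close>
  proof (rule has_round_complexity_Theta_levels[OF g, of "(1 / 2) powr \<gamma>" "2 powr \<gamma>"])
    let ?x = "\<lambda>n. (1 / 2) powr \<gamma> * ?g n"
    have "eventually (\<lambda>n. ?x n + (?x n + 1) * (?x n + exp (1 / 2 * ln (real n)) / 10) \<le> real n) sequentially"
      using assms(1) by real_asymp
    then show "eventually (\<lambda>n. ?x n + (?x n + 1) * (?x n + h (?x n)) \<le> real n) sequentially"
      using eventually_ge_at_top[of 1] by eventually_elim (simp add: h)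
    let ?y = "\<lambda>n. 2 powr \<gamma> * ?g n"
    have "eventually (\<lambda>n. real n < ?y n * (exp (2 * ln (real n)) / 10)) sequentially"
      using assms(1) by real_asymp
    then show "eventually (\<lambda>n. real n < ?y n * h (?y n)) sequentially"
      using eventually_ge_at_top[of 1] by eventually_elim (simp only: h)
  qed auto
qed

theorem theorem18:
  shows "(\<forall>s::real. s > 2 \<longrightarrow>
      (\<exists>f::nat \<Rightarrow> nat. f 0 = 1 \<and> f 1 = 2 \<and> (\<forall>x. f x > x) \<and>
         has_round_complexity_Theta f (\<lambda>n. real n powr (1 / s)))) \<and>
    (\<forall>\<gamma>::real. \<gamma> > 1 \<longrightarrow>
      (\<exists>f::nat \<Rightarrow> nat. f 0 = 1 \<and> f 1 = 2 \<and> (\<forall>x. f x > x) \<and>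
         has_round_complexity_Theta f (\<lambda>n. ln (real n) powr \<gamma>)))"
proof -
  have ex: "\<exists>f::nat \<Rightarrow> nat. f 0 = 1 \<and> f 1 = 2 \<and> (\<forall>x. f x > x) \<and> has_round_complexity_Theta f g"
    if "level_growth h" "has_round_complexity_Theta (next_level (levels h)) g" for h g
    using that level_growth.next_level_levels_small[OF that(1)]
      next_level_gt[OF level_growth.strict_mono_levels[OF that(1)]] by blast
  show ?thesis
    by (intro conjI allI impI ex; (rule Theta_powr Theta_ln_powr; assumption)+)
qed

end
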